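(* Let $\pi/2\le\alpha<\pi$ and let $f(z)=z+\sum_{n=2}^\infty a_nz^n\in\mathcal{MS}(\alpha)$ (with $a_1=1$). Then $|a_n|\le1$ for all $n\in\mathbb{N}=\{1,2,3,\dots\}$.
   Context: $\mathbb{U}=\{z\in\mathbb{C}:|z|<1\}$. $\mathcal{A}$ is the class of functions $f(z)=z+\sum_{n=2}^\infty a_nz^n$ that are analytic and univalent in $\mathbb{U}$. For $\pi/2\le\alpha<\pi$, $\mathcal{MS}(\alpha)$ is the class of all $f\in\mathcal{A}$ such that $$1+\frac{\alpha-\pi}{2\sin\alpha}<\Re\left(\frac{zf'(z)}{f(z)}\right)<1+\frac{\alpha}{2\sin\alpha}\qquad(z\in\mathbb{U}),$$ where $zf'(z)/f(z)$ is given the value $1$ at $z=0$. *)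

theory Defs
  imports "HOL-Complex_Analysis.Complex_Analysis"
begin

abbreviation unit_disk :: "complex set" where
  "unit_disk \<equiv> ball 0 1"

text \<open>\<open>normalized_expansion f a\<close>: \<open>f z = z + (\<Sum>n\<ge>2. a n * z ^ n)\<close> on the unit disk.
  The values \<open>a 0\<close> and \<open>a 1\<close> play no role here.\<close>

definition normalized_expansion :: "(complex \<Rightarrow> complex) \<Rightarrow> (nat \<Rightarrow> complex) \<Rightarrow> bool" where
  "normalized_expansion f a \<longleftrightarrow>
     (\<forall>z\<in>unit_disk. summable (\<lambda>n. a (n + 2) * z ^ (n + 2)) \<and>
        f z = z + (\<Sum>n. a (n + 2) * z ^ (n + 2)))"

definition class_A :: "(complex \<Rightarrow> complex) set" where
  "class_A = {f. (\<exists>a. normalized_expansion f a) \<and>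
                 f analytic_on unit_disk \<and> inj_on f unit_disk}"

text \<open>The quotient \<open>z f'(z) / f(z)\<close>, with its removable singularity at \<open>0\<close> filled in.
  For \<open>f \<in> class_A\<close> no other zero of \<open>f\<close> in the disk exists, since \<open>f 0 = 0\<close> and \<open>f\<close> is
  injective there.\<close>

definition starlike_quotient :: "(complex \<Rightarrow> complex) \<Rightarrow> complex \<Rightarrow> complex" where
  "starlike_quotient f z = (if z = 0 then 1 else z * deriv f z / f z)"

definition class_MS :: "real \<Rightarrow> (complex \<Rightarrow> complex) set" where
  "class_MS \<alpha> = {f \<in> class_A. \<forall>z\<in>unit_disk.
      1 + (\<alpha> - pi) / (2 * sin \<alpha>) < Re (starlike_quotient f z) \<and>
      Re (starlike_quotient f z) < 1 + \<alpha> / (2 * sin \<alpha>)}"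

end

theory Submission
  imports Defs
begin

text \<open>
  Put \<open>p = z f' / f - 1\<close>. This function is holomorphic on the disk, vanishes at \<open>0\<close>, and takes
  its values in the vertical strip \<open>(\<alpha> - \<pi>) / (2 sin \<alpha>) < Re w < \<alpha> / (2 sin \<alpha>)\<close>. The
  factor \<open>1 / (2 sin \<alpha>)\<close> normalizes the strip: the conformal map onto the disk which fixes \<open>0\<close> has
  derivative \<open>1\<close> there, and this is the origin of the bound \<open>1\<close>.

  All Taylor coefficients of \<open>p\<close> have modulus at most \<open>1\<close> (\<open>coeff_le_1_of_strip\<close>). For the
  first coefficient this is Schwarz's lemma applied to \<open>p\<close> followed by the conformal map
  (\<open>norm_deriv_le_1_of_strip\<close>). Rogosinski's averaging argument reduces the \<open>n\<close>-th coefficient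
  to the first: the mean of \<open>p\<close> over the rotations by \<open>n\<close>-th roots of unity keeps exactly
  the powers \<open>z ^ (n * k)\<close>, so it is a function of \<open>z ^ n\<close> whose first coefficient is the \<open>n\<close>-th
  one of \<open>p\<close>, and its values stay in the strip because the strip is convex
  (\<open>convex_image_multisection\<close>).

  Comparing coefficients in \<open>z f' = f + p f\<close> expresses \<open>(n - 1) a\<^sub>n\<close> as a sum of \<open>n - 1\<close> products
  \<open>p\<^sub>k a\<^bsub>n-k\<^esub>\<close> (\<open>fps_recursion_of_log_deriv\<close>), so \<open>\<bar>a\<^sub>n\<bar> \<le> 1\<close> follows by induction
  (\<open>coeff_le_1_of_recursion\<close>).
\<close>

section \<open>Schwarz's lemma for maps into a strip\<close>

text \<open>
  Multiplying the right-hand side by the unit \<open>cis \<alpha>\<close> turns it into the distance of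
  \<open>rcis r \<theta>\<close> from \<open>cis (2 * \<alpha>)\<close>. The points closer to \<open>1\<close> than to \<open>cis (2 * \<alpha>)\<close> are those on
  the side of \<open>1\<close> of the line through \<open>0\<close> in direction \<open>cis \<alpha>\<close>, and that side is the set of
  arguments between \<open>\<alpha> - pi\<close> and \<open>\<alpha>\<close>.
\<close>

lemma norm_diff_less_of_half_plane:
  fixes \<alpha> \<theta> r :: real
  assumes "0 < \<alpha>" "\<alpha> < pi" "\<alpha> - pi < \<theta>" "\<theta> < \<alpha>" "0 < r"
  shows "norm (rcis r \<theta> - 1) < norm (cis \<alpha> - rcis r \<theta> * cis (-\<alpha>))"
proof -
  have "0 < 2 * sin \<alpha> * sin (\<alpha> - \<theta>)"
    using assms by (intro mult_pos_pos sin_gt_zero) auto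
  also have "\<dots> = cos \<theta> - cos (2 * \<alpha> - \<theta>)"
    using sin_times_sin[of \<alpha> "\<alpha> - \<theta>"] by simp
  finally have pos: "0 < 2 * r * (cos \<theta> - cos (2 * \<alpha> - \<theta>))"
    using \<open>0 < r\<close> by simp
  have left: "(norm (rcis r \<theta> - 1))\<^sup>2 = r\<^sup>2 + 1 - 2 * r * cos \<theta>"
  proof -
    have "(norm (rcis r \<theta> - 1))\<^sup>2 = (r * cos \<theta> - 1)\<^sup>2 + (r * sin \<theta>)\<^sup>2"
      by (simp add: cmod_power2)
    also have "\<dots> = r\<^sup>2 + 1 - 2 * r * cos \<theta>"
      using sin_cos_squared_add[of \<theta>] by algebra
    finally show ?thesis .
  qed
  have right: "(norm (cis \<alpha> - rcis r \<theta> * cis (-\<alpha>)))\<^sup>2 = r\<^sup>2 + 1 - 2 * r * cos (2 * \<alpha> - \<theta>)"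
  proof -
    have "rcis r \<theta> * cis (-\<alpha>) = rcis r (\<theta> - \<alpha>)"
      by (simp add: rcis_def cis_mult mult.assoc)
    then have "(norm (cis \<alpha> - rcis r \<theta> * cis (-\<alpha>)))\<^sup>2 =
        (cos \<alpha> - r * cos (\<theta> - \<alpha>))\<^sup>2 + (sin \<alpha> - r * sin (\<theta> - \<alpha>))\<^sup>2"
      by (simp add: cmod_power2)
    also have "\<dots> = r\<^sup>2 + 1 - 2 * r * (cos \<alpha> * cos (\<theta> - \<alpha>) + sin \<alpha> * sin (\<theta> - \<alpha>))"
      using sin_cos_squared_add[of \<alpha>] sin_cos_squared_add[of "\<theta> - \<alpha>"] by algebra
    also have "cos \<alpha> * cos (\<theta> - \<alpha>) + sin \<alpha> * sin (\<theta> - \<alpha>) = cos (2 * \<alpha> - \<theta>)"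
      using cos_diff[of \<alpha> "\<theta> - \<alpha>"] by simp
    finally show ?thesis .
  qed
  show ?thesis
    by (rule power2_less_imp_less) (use left right pos in \<open>auto simp: algebra_simps\<close>)
qed

text \<open>
  The inverse of the Riemann map
  \<open>z \<mapsto> log ((1 + z cis \<alpha>) / (1 + z cis (-\<alpha>))) / (2 \<i> sin \<alpha>)\<close> of the disk onto the strip.
  The exponential of \<open>2 \<i> sin \<alpha> w\<close> opens the strip into the half-plane of the previous lemma, which a Moebius
  transformation sends to the disk.
\<close>

definition strip_to_disk :: "real \<Rightarrow> complex \<Rightarrow> complex" where
  "strip_to_disk \<alpha> w =
     (exp (2 * \<i> * of_real (sin \<alpha>) * w) - 1) /
     (cis \<alpha> - exp (2 * \<i> * of_real (sin \<alpha>) * w) * cis (-\<alpha>))"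

lemma strip_to_disk_image:
  assumes "0 < \<alpha>" "\<alpha> < pi"
    and "(\<alpha> - pi) / (2 * sin \<alpha>) < Re w" "Re w < \<alpha> / (2 * sin \<alpha>)"
  shows "cis \<alpha> - exp (2 * \<i> * of_real (sin \<alpha>) * w) * cis (-\<alpha>) \<noteq> 0"
    and "norm (strip_to_disk \<alpha> w) < 1"
proof -
  have s: "sin \<alpha> > 0" using assms sin_gt_zero by blast
  define \<theta> where "\<theta> = 2 * sin \<alpha> * Re w"
  define r where "r = exp (- (2 * sin \<alpha> * Im w))"
  have E: "exp (2 * \<i> * of_real (sin \<alpha>) * w) = rcis r \<theta>"
    by (simp add: exp_eq_polar rcis_def r_def \<theta>_def)
  have "\<alpha> - pi < \<theta>" "\<theta> < \<alpha>" "0 < r"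
    using assms s by (simp_all add: \<theta>_def r_def field_simps)
  then have less: "norm (rcis r \<theta> - 1) < norm (cis \<alpha> - rcis r \<theta> * cis (-\<alpha>))"
    using assms by (intro norm_diff_less_of_half_plane) auto
  then have pos: "0 < norm (cis \<alpha> - rcis r \<theta> * cis (-\<alpha>))"
    using norm_ge_zero le_less_trans by blast
  then show "cis \<alpha> - exp (2 * \<i> * of_real (sin \<alpha>) * w) * cis (-\<alpha>) \<noteq> 0"
    unfolding E by auto
  show "norm (strip_to_disk \<alpha> w) < 1"
    unfolding strip_to_disk_def E norm_divide using less pos by simp
qed

lemma strip_to_disk_deriv_0:
  assumes "sin \<alpha> \<noteq> 0"
  shows "(strip_to_disk \<alpha> has_field_derivative 1) (at 0)"
proof -
  have ne: "cis \<alpha> - cis (-\<alpha>) = 2 * \<i> * of_real (sin \<alpha>)"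
    by (simp add: complex_eq_iff)
  show ?thesis
    unfolding strip_to_disk_def
    by (rule derivative_eq_intros refl | use ne assms in \<open>simp\<close>)+
qed

lemma norm_deriv_le_1_of_strip:
  assumes "0 < \<alpha>" "\<alpha> < pi"
    and hol: "q holomorphic_on ball 0 1" and "q 0 = 0"
    and strip: "\<And>z. z \<in> ball 0 1 \<Longrightarrow>
      (\<alpha> - pi) / (2 * sin \<alpha>) < Re (q z) \<and> Re (q z) < \<alpha> / (2 * sin \<alpha>)"
  shows "norm (deriv q 0) \<le> 1"
proof -
  let ?h = "\<lambda>z. strip_to_disk \<alpha> (q z)"
  have s: "sin \<alpha> \<noteq> 0" using assms sin_gt_zero[of \<alpha>] by simp
  have "?h holomorphic_on ball 0 1"
    unfolding strip_to_disk_def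
    using strip_to_disk_image(1)[OF assms(1,2)] strip
    by (intro holomorphic_intros hol) blast
  moreover have "?h 0 = 0" using \<open>q 0 = 0\<close> by (simp add: strip_to_disk_def)
  moreover have "norm (?h z) < 1" if "norm z < 1" for z
    using strip_to_disk_image(2)[OF assms(1,2)] strip that by simp
  ultimately have "norm (deriv ?h 0) \<le> 1"
    using Schwarz_Lemma(2)[of ?h 0] by simp
  moreover have "(?h has_field_derivative 1 * deriv q 0) (at 0)"
    using holomorphic_derivI[OF hol, of 0] strip_to_disk_deriv_0[OF s] \<open>q 0 = 0\<close>
    by (intro DERIV_chain2[of "strip_to_disk \<alpha>"]) auto
  ultimately show ?thesis using DERIV_imp_deriv by fastforce
qed

section \<open>Rogosinski's bound for the Taylor coefficients\<close>

lemma sum_power_root_of_unity: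
  fixes n m :: nat
  assumes "n \<ge> 1"
  shows "(\<Sum>j<n. (exp (2 * of_real pi * \<i> / of_nat n) ^ j) ^ m) =
    (if n dvd m then of_nat n else (0::complex))"
proof -
  let ?\<omega> = "exp (2 * of_real pi * \<i> / of_nat n)"
  let ?\<zeta> = "?\<omega> ^ m"
  have \<zeta>: "?\<zeta> = exp (2 * of_real pi * \<i> * of_nat m / of_nat n)"
    by (simp add: exp_of_nat_mult[symmetric] mult_ac)
  have swap: "(?\<omega> ^ j) ^ m = ?\<zeta> ^ j" for j
    by (simp add: power_mult[symmetric] mult.commute)
  have root: "?\<zeta> = 1 \<longleftrightarrow> n dvd m"
    unfolding \<zeta> by (rule complex_root_unity_eq_1[OF assms])
  have "?\<zeta> ^ n = 1"
    using complex_root_unity[of n m] assms unfolding \<zeta> by simp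
  then show ?thesis
    unfolding swap using root geometric_sum[of ?\<zeta> n] by auto
qed

text \<open>
  With \<open>w = z ^ n\<close>, the value of the new series at \<open>w\<close> is the mean of the values of \<open>P\<close> at the
  points \<open>\<omega> ^ j * z\<close> for a primitive \<open>n\<close>-th root of unity \<open>\<omega>\<close>, because this mean
  annihilates every power of \<open>z\<close> whose exponent \<open>n\<close> does not divide. It is a convex
  combination of points of \<open>C\<close>.
\<close>

lemma convex_image_multisection:
  fixes P :: "complex fps" and C :: "complex set"
  assumes "n \<ge> 1" and rad: "fps_conv_radius P \<ge> 1" and "convex C"
    and img: "\<And>z. z \<in> ball 0 1 \<Longrightarrow> eval_fps P z \<in> C"
  defines "Q \<equiv> Abs_fps (\<lambda>k. fps_nth P (n * k))"
  shows "fps_conv_radius Q \<ge> 1"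
    and "\<And>w. w \<in> ball 0 1 \<Longrightarrow> eval_fps Q w \<in> C"
proof -
  have key: "(\<lambda>k. fps_nth Q k * w ^ k) sums eval_fps Q w \<and> eval_fps Q w \<in> C"
    if w: "norm w < 1" for w :: complex
  proof -
    define \<omega> :: complex where "\<omega> = exp (2 * of_real pi * \<i> / of_nat n)"
    have norm_\<omega>: "norm \<omega> = 1" by (simp add: \<omega>_def norm_exp_eq_Re)
    obtain z where z: "z ^ n = w"
      using exists_complex_root[of n w] assms(1) by auto
    have norm_z: "norm z < 1"
    proof (rule ccontr)
      assume "\<not> norm z < 1"
      then have "norm z ^ n \<ge> 1" by (simp add: one_le_power)
      then show False using w unfolding z[symmetric] by (simp add: norm_power)
    qed
    have rot: "norm (\<omega> ^ j * z) < 1" for j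
      using norm_z norm_\<omega> by (simp add: norm_mult norm_power)
    define A where "A = (\<Sum>j<n. (1 / real n) *\<^sub>R eval_fps P (\<omega> ^ j * z))"
    have "A \<in> C"
      unfolding A_def using assms(1) rot
      by (intro convex_sum \<open>convex C\<close> img) auto
    have "(\<lambda>m. \<Sum>j<n. (1 / real n) *\<^sub>R (fps_nth P m * (\<omega> ^ j * z) ^ m)) sums A"
      unfolding A_def using rot
      by (intro sums_sum sums_scaleR_right sums_eval_fps less_le_trans[OF _ rad])
         (simp add: one_ereal_def)
    also have "(\<lambda>m. \<Sum>j<n. (1 / real n) *\<^sub>R (fps_nth P m * (\<omega> ^ j * z) ^ m)) =
        (\<lambda>m. if n dvd m then fps_nth P m * z ^ m else 0)"
    proof
      fix m
      have "(\<Sum>j<n. (1 / real n) *\<^sub>R (fps_nth P m * (\<omega> ^ j * z) ^ m)) =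
          (1 / of_nat n) * (fps_nth P m * z ^ m) * (\<Sum>j<n. (\<omega> ^ j) ^ m)"
        by (simp add: sum_distrib_left scaleR_conv_of_real power_mult_distrib divide_inverse mult_ac)
      also have "\<dots> = (if n dvd m then fps_nth P m * z ^ m else 0)"
        unfolding \<omega>_def sum_power_root_of_unity[OF assms(1)] using assms(1) by simp
      finally show "(\<Sum>j<n. (1 / real n) *\<^sub>R (fps_nth P m * (\<omega> ^ j * z) ^ m)) = \<dots>" .
    qed
    finally have "(\<lambda>m. if n dvd m then fps_nth P m * z ^ m else 0) sums A" .
    then have "(\<lambda>k. (\<lambda>m. if n dvd m then fps_nth P m * z ^ m else 0) (n * k)) sums A"
      using assms(1) by (subst sums_mono_reindex) (auto simp: strict_mono_def)
    then have "(\<lambda>k. fps_nth Q k * w ^ k) sums A"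
      by (simp add: Q_def z[symmetric] power_mult)
    then show ?thesis
      using \<open>A \<in> C\<close> unfolding eval_fps_def by (simp add: sums_iff)
  qed
  show "fps_conv_radius Q \<ge> 1"
    unfolding fps_conv_radius_def
  proof (rule conv_radius_geI_ex')
    fix r :: real assume "0 < r" "ereal r < 1"
    then show "summable (\<lambda>k. fps_nth Q k * of_real r ^ k)"
      using key[of "of_real r"] by (auto simp: sums_iff)
  qed
  show "eval_fps Q w \<in> C" if "w \<in> ball 0 1" for w
    using key[of w] that by simp
qed

lemma fps_nth_1_eq_deriv_eval_fps:
  fixes Q :: "complex fps"
  assumes "fps_conv_radius Q > 0"
  shows "fps_nth Q 1 = deriv (eval_fps Q) 0"
  using fps_nth_conv_deriv[OF assms, of 1] by simp

lemma coeff_le_1_of_strip: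
  fixes P :: "complex fps"
  assumes "0 < \<alpha>" "\<alpha> < pi" and rad: "fps_conv_radius P \<ge> 1" and "fps_nth P 0 = 0"
    and strip: "\<And>z. z \<in> ball 0 1 \<Longrightarrow>
      (\<alpha> - pi) / (2 * sin \<alpha>) < Re (eval_fps P z) \<and> Re (eval_fps P z) < \<alpha> / (2 * sin \<alpha>)"
    and "n \<ge> 1"
  shows "norm (fps_nth P n) \<le> 1"
proof -
  define C where "C = {w. (\<alpha> - pi) / (2 * sin \<alpha>) < Re w} \<inter> {w. Re w < \<alpha> / (2 * sin \<alpha>)}"
  define Q where "Q = Abs_fps (\<lambda>k. fps_nth P (n * k))"
  have "convex C"
    unfolding C_def by (intro convex_Int convex_halfspace_Re_gt convex_halfspace_Re_lt)
  moreover have "eval_fps P z \<in> C" if "z \<in> ball 0 1" for z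
    using strip[OF that] by (simp add: C_def)
  ultimately have radQ: "fps_conv_radius Q \<ge> 1"
    and imgQ: "\<And>w. w \<in> ball 0 1 \<Longrightarrow> eval_fps Q w \<in> C"
    unfolding Q_def using convex_image_multisection[OF \<open>n \<ge> 1\<close> rad] by blast+
  have "norm (deriv (eval_fps Q) 0) \<le> 1"
  proof (rule norm_deriv_le_1_of_strip[OF assms(1,2)])
    show "eval_fps Q holomorphic_on ball 0 1"
      using radQ by (intro holomorphic_on_eval_fps ball_eball_mono) (simp add: one_ereal_def)
    show "eval_fps Q 0 = 0" using \<open>fps_nth P 0 = 0\<close> by (simp add: eval_fps_at_0 Q_def)
  qed (use imgQ in \<open>auto simp: C_def\<close>)
  moreover have "fps_conv_radius Q > 0"
    by (rule less_le_trans[OF _ radQ]) simp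
  ultimately show ?thesis
    using fps_nth_1_eq_deriv_eval_fps[of Q] by (simp add: Q_def)
qed

section \<open>The recursion for the coefficients of a starlike function\<close>

lemma coeff_le_1_of_recursion:
  fixes a p :: "nat \<Rightarrow> complex"
  assumes "norm (a 1) \<le> 1" and p: "\<And>k. k \<ge> 1 \<Longrightarrow> norm (p k) \<le> 1"
    and rec: "\<And>n. n \<ge> 2 \<Longrightarrow> of_nat (n - 1) * a n = (\<Sum>k=1..n-1. p k * a (n - k))"
    and "n \<ge> 1"
  shows "norm (a n) \<le> 1"
  using \<open>n \<ge> 1\<close>
proof (induction n rule: less_induct)
  case (less n)
  show ?case
  proof (cases "n = 1")
    case False
    then have n: "n \<ge> 2" using less.prems by simp
    have "real (n - 1) * norm (a n) = norm (\<Sum>k=1..n-1. p k * a (n - k))"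
      using arg_cong[OF rec[OF n], of norm] by (simp only: norm_mult norm_of_nat)
    also have "\<dots> \<le> (\<Sum>k=1..n-1. 1)"
    proof (rule sum_norm_le)
      fix k assume k: "k \<in> {1..n-1}"
      then have "norm (a (n - k)) \<le> 1" by (intro less.IH) auto
      then show "norm (p k * a (n - k)) \<le> 1"
        using p[of k] k by (simp add: norm_mult mult_le_one)
    qed
    also have "\<dots> = real (n - 1)" by simp
    finally show ?thesis using n by (simp add: mult_le_cancel_left1)
  qed (use assms(1) in simp)
qed

text \<open>
  The vanishing constant terms remove both ends \<open>k = 0\<close> and \<open>k = n\<close> of the Cauchy product,
  so only coefficients of \<open>F\<close> of smaller positive index remain.
\<close>

lemma fps_recursion_of_log_deriv:
  fixes F P :: "complex fps"
  assumes eq: "fps_X * fps_deriv F = F + P * F"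
    and "fps_nth F 0 = 0" "fps_nth P 0 = 0" "n \<ge> 2"
  shows "of_nat (n - 1) * fps_nth F n = (\<Sum>k=1..n-1. fps_nth P k * fps_nth F (n - k))"
proof -
  have "fps_nth (fps_X * fps_deriv F) n = of_nat n * fps_nth F n"
    using \<open>n \<ge> 2\<close> by (cases n) simp_all
  then have "of_nat n * fps_nth F n = fps_nth F n + (\<Sum>k=0..n. fps_nth P k * fps_nth F (n - k))"
    unfolding eq by (simp add: fps_mult_nth)
  also have "(\<Sum>k=0..n. fps_nth P k * fps_nth F (n - k)) =
      (\<Sum>k=1..n-1. fps_nth P k * fps_nth F (n - k))"
  proof (rule sum.mono_neutral_right)
    show "\<forall>i\<in>{0..n} - {1..n - 1}. fps_nth P i * fps_nth F (n - i) = 0"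
    proof
      fix i assume "i \<in> {0..n} - {1..n - 1}"
      then have "i = 0 \<or> i = n" by auto
      then show "fps_nth P i * fps_nth F (n - i) = 0" using assms(2,3) by auto
    qed
  qed auto
  finally show ?thesis using \<open>n \<ge> 2\<close> by (simp add: of_nat_diff algebra_simps)
qed

text \<open>
  The given expansion prescribes neither \<open>a 0\<close> nor \<open>a 1\<close>, so the power series of \<open>f\<close> has to
  replace them by \<open>0\<close> and \<open>1\<close>.
\<close>

lemma normalized_expansion_eval_fps:
  assumes "normalized_expansion f a"
  defines "F \<equiv> Abs_fps (\<lambda>n. if n = 0 then 0 else if n = 1 then 1 else a n)"
  shows "fps_conv_radius F \<ge> 1"
    and "\<And>z. z \<in> unit_disk \<Longrightarrow> eval_fps F z = f z"
proof -
  have sums: "(\<lambda>n. fps_nth F n * z ^ n) sums f z" if "z \<in> unit_disk" for z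
  proof -
    have "(\<lambda>n. fps_nth F (n + 2) * z ^ (n + 2)) sums (f z - z)"
      using assms(1) that by (simp add: normalized_expansion_def F_def sums_iff)
    then show ?thesis
      by (subst (asm) sums_iff_shift) (simp add: F_def numeral_2_eq_2)
  qed
  show "fps_conv_radius F \<ge> 1"
    unfolding fps_conv_radius_def
  proof (rule conv_radius_geI_ex')
    fix r :: real assume "0 < r" "ereal r < 1"
    then show "summable (\<lambda>k. fps_nth F k * of_real r ^ k)"
      using sums[of "of_real r"] by (auto simp: sums_iff)
  qed
  show "eval_fps F z = f z" if "z \<in> unit_disk" for z
    using sums[OF that] by (simp add: eval_fps_def sums_iff)
qed

text \<open>
  Writing \<open>f z = z * g z\<close> removes the singularity at \<open>0\<close>: the quotient is \<open>deriv f / g\<close>, where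
  \<open>g\<close> has no zero because the injective \<open>f\<close> vanishes only at \<open>0\<close> and \<open>g 0 = deriv f 0 = 1\<close>.
\<close>

lemma starlike_quotient_holomorphic:
  assumes hol: "f holomorphic_on unit_disk" and inj: "inj_on f unit_disk"
    and "f 0 = 0" and "deriv f 0 = 1"
  shows "starlike_quotient f holomorphic_on unit_disk"
proof -
  obtain g where g: "g holomorphic_on unit_disk"
    and fg: "\<And>z. norm z < 1 \<Longrightarrow> f z = z * g z" and g0: "deriv f 0 = g 0"
    using Schwarz3[OF hol \<open>f 0 = 0\<close>] by metis
  have g_ne: "g z \<noteq> 0" if "z \<in> unit_disk" for z
  proof (cases "z = 0")
    case False
    then have "f z \<noteq> f 0" using inj_onD[OF inj, of z 0] that by auto
    then show ?thesis using fg[of z] \<open>f 0 = 0\<close> that by auto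
  qed (use g0 \<open>deriv f 0 = 1\<close> in simp)
  have "(\<lambda>z. deriv f z / g z) holomorphic_on unit_disk"
    using g_ne by (intro holomorphic_intros holomorphic_deriv hol g) auto
  moreover have "deriv f z / g z = starlike_quotient f z" if "z \<in> unit_disk" for z
    using that fg[of z] g0 \<open>deriv f 0 = 1\<close> by (auto simp: starlike_quotient_def)
  ultimately show ?thesis by (rule holomorphic_transform)
qed

section \<open>Coefficient bound\<close>

theorem theorem4:
  fixes \<alpha> :: real and f :: "complex \<Rightarrow> complex" and a :: "nat \<Rightarrow> complex"
  assumes "pi / 2 \<le> \<alpha>" and "\<alpha> < pi"
    and "f \<in> class_MS \<alpha>"
    and "normalized_expansion f a" and "a 1 = 1"
  shows "\<forall>n\<ge>1. norm (a n) \<le> 1"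
proof -
  define F where "F = Abs_fps (\<lambda>n. if n = 0 then 0 else if n = 1 then 1 else a n)"
  define p where "p z = starlike_quotient f z - 1" for z
  define P where "P = fps_expansion p 0"
  have \<alpha>: "0 < \<alpha>" using assms(1) pi_gt_zero by linarith
  have hol: "f holomorphic_on unit_disk" and inj: "inj_on f unit_disk"
    and strip: "\<And>z. z \<in> unit_disk \<Longrightarrow>
      (\<alpha> - pi) / (2 * sin \<alpha>) < Re (p z) \<and> Re (p z) < \<alpha> / (2 * sin \<alpha>)"
    using assms(3) analytic_imp_holomorphic
    by (force simp: class_MS_def class_A_def p_def)+
  have radF: "fps_conv_radius F \<ge> 1"
    and evalF: "\<And>z. z \<in> unit_disk \<Longrightarrow> eval_fps F z = f z"
    unfolding F_def using normalized_expansion_eval_fps[OF assms(4)] by auto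
  have near_0: "eventually (\<lambda>z::complex. z \<in> unit_disk) (nhds 0)"
    by (rule eventually_nhds_in_open) auto
  have expF: "f has_fps_expansion F"
    unfolding has_fps_expansion_def using radF evalF near_0
    by (auto intro!: less_le_trans[OF _ radF] elim!: eventually_mono)
  have "f 0 = 0" using evalF[of 0] by (simp add: eval_fps_at_0 F_def)
  have "deriv f 0 = 1" using fps_nth_fps_expansion[OF expF, of 1] by (simp add: F_def)
  have holp: "p holomorphic_on unit_disk"
    unfolding p_def
    by (intro holomorphic_intros starlike_quotient_holomorphic hol inj)
       (fact \<open>f 0 = 0\<close> \<open>deriv f 0 = 1\<close>)+
  have holp': "p holomorphic_on eball 0 1" using holp by (simp add: one_ereal_def)
  have radP: "fps_conv_radius P \<ge> 1"
    unfolding P_def by (rule conv_radius_fps_expansion[OF holp'])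
  have evalP: "eval_fps P z = p z" if "z \<in> unit_disk" for z
    unfolding P_def using that eval_fps_expansion'[OF holp', of z]
    by (simp add: one_ereal_def)
  have expP: "p has_fps_expansion P"
    unfolding P_def by (rule has_fps_expansion_fps_expansion[OF _ _ holp]) auto
  have P0: "fps_nth P 0 = 0"
    using evalP[of 0] by (simp add: eval_fps_at_0 p_def starlike_quotient_def)
  have "z * deriv f z = f z + p z * f z" if "z \<in> unit_disk" for z
    using inj_onD[OF inj, of z 0] that \<open>f 0 = 0\<close>
    by (auto simp: p_def starlike_quotient_def field_simps)
  then have "eventually (\<lambda>z. z * deriv f z = f z + p z * f z) (nhds 0)"
    using near_0 by (auto elim: eventually_mono)
  moreover have "(\<lambda>z. z * deriv f z) has_fps_expansion fps_X * fps_deriv F"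
    by (intro fps_expansion_intros expF)
  ultimately have "(\<lambda>z. f z + p z * f z) has_fps_expansion fps_X * fps_deriv F"
    by (simp cong: has_fps_expansion_cong)
  moreover have "(\<lambda>z. f z + p z * f z) has_fps_expansion F + P * F"
    by (intro fps_expansion_intros expF expP)
  ultimately have "fps_X * fps_deriv F = F + P * F"
    by (rule fps_expansion_unique_complex)
  note rec = fps_recursion_of_log_deriv[OF this _ P0]
  have P_le: "norm (fps_nth P k) \<le> 1" if "k \<ge> 1" for k
    by (rule coeff_le_1_of_strip[OF \<alpha> assms(2) radP P0 _ that]) (simp add: evalP strip)
  have "norm (fps_nth F n) \<le> 1" if "n \<ge> 1" for n
    by (rule coeff_le_1_of_recursion[where a = "fps_nth F", OF _ P_le rec that])
       (simp_all add: F_def)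
  moreover have "fps_nth F n = a n" if "n \<ge> 1" for n
    using that \<open>a 1 = 1\<close> by (simp add: F_def)
  ultimately show ?thesis by simp
qed

end
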